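(* For each odd $n\in\mathbb{N}$ let $x_n$ be the negative real root of the equation $z^{n+1}=(1+z)^n$. Then, as $n\to\infty$ through odd integers, $x_n$ converges to $-\tfrac12$ with asymptotic approximation $-\tfrac12-\frac{\ln 2}{4n}$; that is, $x_n=-\tfrac12+\epsilon_n$ with $\epsilon_n\to0$ and $$\epsilon_n\sim-\frac{\ln 2}{4n}.$$
   Context: $\mathbb{N}=\{1,2,3,\dots\}$. For each odd $n\in\mathbb{N}$ the equation $z^{n+1}=(1+z)^n$ has exactly one negative real root, and it lies in $(-1,0)$, so $x_n$ is well defined. The notation $a_n\sim b_n$ means $a_n/b_n\to1$. *)

theory Defs
  imports Complex_Main "HOL-Library.Landau_Symbols"
begin

text \<open>Only meaningful for odd \<open>n\<close>, where the root exists and is unique.\<close>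

definition neg_root :: "nat \<Rightarrow> real" where
  "neg_root n = (THE z. z < 0 \<and> z ^ (n + 1) = (1 + z) ^ n)"

definition odd_at_top :: "nat filter" where
  "odd_at_top = inf at_top (principal {n. odd n})"

end

theory Submission
  imports Defs "HOL-Real_Asymp.Real_Asymp"
begin

text \<open>Put \<open>y = -z\<close>. For odd \<open>n\<close> the equation becomes \<open>y ^ (n + 1) = (1 - y) ^ n\<close> with
  \<open>0 < y < 1\<close>; the left side increases in \<open>y\<close> and the right side decreases, so comparing the two sides
  at a point \<open>c\<close> decides on which side of \<open>c\<close> the root lies. At \<open>c = 1/2 + a/n\<close> the logarithm of
  the quotient of the two sides tends to \<open>4 * a - ln 2\<close>, which changes sign at \<open>a = ln 2 / 4\<close>. Hence
  \<open>n * (y - 1/2)\<close> tends to \<open>ln 2 / 4\<close>.\<close>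

lemma power_diff_one_minus_power_strict_mono:
  fixes x y :: real
  assumes "0 \<le> x" "x < y" "y \<le> 1"
  shows "x ^ (n + 1) - (1 - x) ^ n < y ^ (n + 1) - (1 - y) ^ n"
proof -
  have "x ^ (n + 1) < y ^ (n + 1)"
    using assms by (intro power_strict_mono) auto
  moreover have "(1 - y) ^ n \<le> (1 - x) ^ n"
    using assms by (intro power_mono) auto
  ultimately show ?thesis by linarith
qed

text \<open>For \<open>z \<le> -1\<close> the odd power \<open>(1 + z) ^ n\<close> is nonpositive,
  whereas the even power \<open>z ^ (n + 1)\<close> is positive.\<close>

lemma negative_solution_greater_minus_1:
  fixes z :: real
  assumes "odd n" "z < 0" "z ^ (n + 1) = (1 + z) ^ n"
  shows "-1 < z"
proof (rule ccontr)
  assume "\<not> -1 < z"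
  then have "(1 + z) ^ n \<le> 0"
    using \<open>odd n\<close> by (simp add: power_le_zero_eq odd_pos)
  moreover have "0 < z ^ (n + 1)"
    using assms(1,2) by (simp only: zero_less_power_eq) simp
  ultimately show False using assms(3) by simp
qed

lemma neg_root_equation_iff:
  fixes z :: real
  assumes "odd n"
  shows "z ^ (n + 1) = (1 + z) ^ n \<longleftrightarrow> (- z) ^ (n + 1) - (1 - (- z)) ^ n = 0"
  using assms by (simp add: power_minus_even)

text \<open>This makes the \<open>THE\<close> in \<open>neg_root\<close> meaningful. Existence is
  the intermediate value theorem on the unit interval; uniqueness is strict monotonicity there,
  which applies since every negative solution exceeds -1.\<close>

lemma ex1_neg_root:
  assumes "odd n"
  shows "\<exists>!z::real. z < 0 \<and> z ^ (n + 1) = (1 + z) ^ n"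
proof -
  define g where "g y = y ^ (n + 1) - (1 - y) ^ n" for y :: real
  have "n > 0" using assms by (simp add: odd_pos)
  \<comment> \<open>The endpoint values are \<open>g 0 = -1\<close> and \<open>g 1 = 1\<close>; the
    first one also rules out \<open>y = 0\<close> below.\<close>
  have "\<exists>y. 0 \<le> y \<and> y \<le> 1 \<and> g y = 0"
    using \<open>n > 0\<close> unfolding g_def by (intro IVT') (auto intro!: continuous_intros simp: power_0_left)
  then obtain y where y: "0 \<le> y" "y \<le> 1" "g y = 0" by blast
  have "y \<noteq> 0" using y \<open>n > 0\<close> by (auto simp: g_def)
  have eq: "z ^ (n + 1) = (1 + z) ^ n \<longleftrightarrow> g (- z) = 0" for z
    unfolding g_def by (rule neg_root_equation_iff[OF assms])
  show ?thesis
  proof (rule ex1I)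
    show "- y < 0 \<and> (- y) ^ (n + 1) = (1 + - y) ^ n"
      using y \<open>y \<noteq> 0\<close> eq[of "- y"] by simp
  next
    fix z :: real
    assume z: "z < 0 \<and> z ^ (n + 1) = (1 + z) ^ n"
    then have "-1 < z" using negative_solution_greater_minus_1[OF assms] by blast
    moreover have "g (- z) = 0" using z eq by blast
    ultimately have "\<not> - z < y" "\<not> y < - z"
      using power_diff_one_minus_power_strict_mono[of "- z" y n]
        power_diff_one_minus_power_strict_mono[of y "- z" n] y z
      unfolding g_def by auto
    then show "z = - y" by linarith
  qed
qed

lemma
  assumes "odd n"
  shows neg_root_less_0: "neg_root n < 0"
    and neg_root_equation: "neg_root n ^ (n + 1) = (1 + neg_root n) ^ n"
  using theI'[OF ex1_neg_root[OF assms]] unfolding neg_root_def by auto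

text \<open>The difference of the two sides is negative at \<open>c\<close> and vanishes at
  \<open>- neg_root n\<close>, so by monotonicity \<open>c\<close> lies to the left of
  \<open>- neg_root n\<close>.\<close>

lemma neg_root_less:
  assumes "odd n" "0 < c" "c < 1" "c ^ (n + 1) < (1 - c) ^ n"
  shows "neg_root n < - c"
proof (rule ccontr)
  assume "\<not> neg_root n < - c"
  then have "- neg_root n = c \<or> - neg_root n < c" by linarith
  then show False
    using power_diff_one_minus_power_strict_mono[of "- neg_root n" c n] assms
      neg_root_less_0[OF assms(1)] neg_root_equation[OF assms(1)]
      neg_root_equation_iff[OF assms(1), of "neg_root n"] by fastforce
qed

lemma neg_root_greater:
  assumes "odd n" "0 < c" "c < 1" "(1 - c) ^ n < c ^ (n + 1)"
  shows "- c < neg_root n"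
proof (rule ccontr)
  assume "\<not> - c < neg_root n"
  then have "- neg_root n = c \<or> c < - neg_root n" by linarith
  \<comment> \<open>Monotonicity is now used up to \<open>- neg_root n\<close>, which therefore has
    to be at most 1.\<close>
  moreover have "-1 < neg_root n"
    using negative_solution_greater_minus_1 assms(1) neg_root_less_0 neg_root_equation by blast
  ultimately show False
    using power_diff_one_minus_power_strict_mono[of c "- neg_root n" n] assms
      neg_root_equation[OF assms(1)]
      neg_root_equation_iff[OF assms(1), of "neg_root n"] by fastforce
qed

lemma power_less_power_iff_ln:
  fixes x y :: real
  assumes "0 < x" "0 < y"
  shows "x ^ m < y ^ n \<longleftrightarrow> real m * ln x < real n * ln y"
  using assms by (simp flip: ln_realpow)

lemma odd_at_top_le: "odd_at_top \<le> at_top"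
  by (simp add: odd_at_top_def)

lemma eventually_odd_at_top: "eventually odd odd_at_top"
  by (simp add: odd_at_top_def eventually_inf_principal)

text \<open>The \<open>n\<close>-fold difference of logarithms is
  \<open>n * ln ((1 + 2 * a / n) / (1 - 2 * a / n))\<close>, which tends to \<open>4 * a\<close>;
  the one extra factor on the left side contributes \<open>ln (1 / 2) = - ln 2\<close>.\<close>

lemma ln_quotient_tendsto:
  fixes a :: real
  shows "(\<lambda>n. real (n + 1) * ln (1 / 2 + a / real n) - real n * ln (1 - (1 / 2 + a / real n)))
    \<longlonglongrightarrow> 4 * a - ln 2"
  by (real_asymp simp: ln_div)

lemma eventually_shifted_half_in_unit_interval:
  fixes a :: real
  shows "\<forall>\<^sub>F n in sequentially. 0 < 1 / 2 + a / real n \<and> 1 / 2 + a / real n < 1"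
  by (intro eventually_conj; real_asymp)

lemma eventually_neg_root_less:
  assumes "a < ln 2 / 4"
  shows "\<forall>\<^sub>F n in odd_at_top. neg_root n < - (1 / 2 + a / real n)"
proof -
  have "\<forall>\<^sub>F n in sequentially.
      real (n + 1) * ln (1 / 2 + a / real n) - real n * ln (1 - (1 / 2 + a / real n)) < 0"
    by (rule order_tendstoD(2)[OF ln_quotient_tendsto]) (use assms in simp)
  then have "\<forall>\<^sub>F n in odd_at_top. odd n \<and> (0 < 1 / 2 + a / real n \<and> 1 / 2 + a / real n < 1) \<and>
      real (n + 1) * ln (1 / 2 + a / real n) - real n * ln (1 - (1 / 2 + a / real n)) < 0"
    by (intro eventually_conj eventually_odd_at_top filter_leD[OF odd_at_top_le]
        eventually_shifted_half_in_unit_interval)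
  then show ?thesis
  proof eventually_elim
    case (elim n)
    then show ?case
      by (intro neg_root_less) (auto simp only: power_less_power_iff_ln)
  qed
qed

lemma eventually_neg_root_greater:
  assumes "ln 2 / 4 < a"
  shows "\<forall>\<^sub>F n in odd_at_top. - (1 / 2 + a / real n) < neg_root n"
proof -
  have "\<forall>\<^sub>F n in sequentially.
      0 < real (n + 1) * ln (1 / 2 + a / real n) - real n * ln (1 - (1 / 2 + a / real n))"
    by (rule order_tendstoD(1)[OF ln_quotient_tendsto]) (use assms in simp)
  then have "\<forall>\<^sub>F n in odd_at_top. odd n \<and> (0 < 1 / 2 + a / real n \<and> 1 / 2 + a / real n < 1) \<and>
      0 < real (n + 1) * ln (1 / 2 + a / real n) - real n * ln (1 - (1 / 2 + a / real n))"
    by (intro eventually_conj eventually_odd_at_top filter_leD[OF odd_at_top_le]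
        eventually_shifted_half_in_unit_interval)
  then show ?thesis
  proof eventually_elim
    case (elim n)
    then show ?case
      by (intro neg_root_greater) (auto simp only: power_less_power_iff_ln)
  qed
qed

lemma scaled_neg_root_tendsto:
  "((\<lambda>n. real n * (neg_root n + 1 / 2)) \<longlongrightarrow> - (ln 2 / 4)) odd_at_top"
proof (rule order_tendstoI)
  fix b :: real
  assume "b < - (ln 2 / 4)"
  \<comment> \<open>The comparison point approximates \<open>- neg_root n\<close>, so a bound
    \<open>b\<close> on the scaled root corresponds to \<open>a = - b\<close>.\<close>
  then have "\<forall>\<^sub>F n in odd_at_top. - (1 / 2 + (- b) / real n) < neg_root n"
    by (intro eventually_neg_root_greater) simp
  with eventually_odd_at_top show "\<forall>\<^sub>F n in odd_at_top. b < real n * (neg_root n + 1 / 2)"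
  proof eventually_elim
    case (elim n)
    then have "b / real n < neg_root n + 1 / 2" by simp
    then show ?case using \<open>odd n\<close> by (simp add: odd_pos pos_divide_less_eq mult.commute)
  qed
next
  fix b :: real
  assume "- (ln 2 / 4) < b"
  then have "\<forall>\<^sub>F n in odd_at_top. neg_root n < - (1 / 2 + (- b) / real n)"
    by (intro eventually_neg_root_less) simp
  with eventually_odd_at_top show "\<forall>\<^sub>F n in odd_at_top. real n * (neg_root n + 1 / 2) < b"
  proof eventually_elim
    case (elim n)
    then have "neg_root n + 1 / 2 < b / real n" by simp
    then show ?case using \<open>odd n\<close> by (simp add: odd_pos pos_less_divide_eq mult.commute)
  qed
qed

theorem theorem2p12:
  shows "(neg_root \<longlongrightarrow> - 1 / 2) odd_at_top \<and>
    (\<exists>\<epsilon> :: nat \<Rightarrow> real.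
      (\<forall>n. odd n \<longrightarrow> neg_root n = - 1 / 2 + \<epsilon> n) \<and>
      (\<epsilon> \<longlongrightarrow> 0) odd_at_top \<and>
      \<epsilon> \<sim>[odd_at_top] (\<lambda>n. - (ln 2 / (4 * real n))))"
proof -
  define \<epsilon> where "\<epsilon> n = neg_root n + 1 / 2" for n
  have scaled: "((\<lambda>n. real n * \<epsilon> n) \<longlongrightarrow> - (ln 2 / 4)) odd_at_top"
    unfolding \<epsilon>_def by (rule scaled_neg_root_tendsto)
  have "((\<lambda>n. 1 / real n) \<longlongrightarrow> 0) odd_at_top"
    by (rule tendsto_mono[OF odd_at_top_le lim_1_over_n])
  from tendsto_mult[OF scaled this]
  have "((\<lambda>n. real n * \<epsilon> n * (1 / real n)) \<longlongrightarrow> 0) odd_at_top"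
    by simp
  \<comment> \<open>Cancelling \<open>real n\<close> requires \<open>n \<noteq> 0\<close>, which
    oddness supplies.\<close>
  then have lim0: "(\<epsilon> \<longlongrightarrow> 0) odd_at_top"
    by (rule Lim_transform_eventually)
      (use eventually_odd_at_top in eventually_elim, auto simp: odd_pos)
  have "((\<lambda>n. real n * \<epsilon> n * (- (4 / ln 2))) \<longlongrightarrow> 1) odd_at_top"
    using tendsto_mult_right[OF scaled, of "- (4 / ln 2)"] by simp
  \<comment> \<open>The two functions agree for every \<open>n\<close>: at \<open>n = 0\<close> both
    are 0, as division by zero yields 0.\<close>
  then have "((\<lambda>n. \<epsilon> n / (- (ln 2 / (4 * real n)))) \<longlongrightarrow> 1) odd_at_top"
    by (rule Lim_transform_eventually) (auto intro!: always_eventually)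
  then have equiv: "\<epsilon> \<sim>[odd_at_top] (\<lambda>n. - (ln 2 / (4 * real n)))"
    by (rule asymp_equivI')
  have "((\<lambda>n. - 1 / 2 + \<epsilon> n) \<longlongrightarrow> - 1 / 2 + 0) odd_at_top"
    by (intro tendsto_intros lim0)
  then have "(neg_root \<longlongrightarrow> - 1 / 2) odd_at_top"
    by (simp add: \<epsilon>_def)
  moreover have "\<forall>n. odd n \<longrightarrow> neg_root n = - 1 / 2 + \<epsilon> n"
    by (simp add: \<epsilon>_def)
  ultimately show ?thesis using lim0 equiv by blast
qed

end
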